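(* Let $\mathscr A$ be an algebra of subsets of a nonempty set $\Omega$ and let $\mathscr M\subset ba(\mathscr A)$. Then $\mathscr M$ is dominated, i.e. there exists $\lambda\in ba(\mathscr A)_+$ such that $\mu\ll\lambda$ for every $\mu\in\mathscr M$, if and only if there exists $m\in\mathbf A(\mathscr M)$ such that $\mu\ll m$ for every $\mu\in\mathscr M$.
   Context: $ba(\mathscr A)$ denotes the space of bounded, finitely additive real-valued set functions on the algebra $\mathscr A$ (no countable additivity is assumed, and $\mathscr A$ need not be a $\sigma$-algebra); $ba(\mathscr A)_+$ denotes its nonnegative elements. For $\mu\in ba(\mathscr A)$, $|\mu|$ is its total variation measure and $\|\mu\|=|\mu|(\Omega)$. For $\mu,\nu\in ba(\mathscr A)$, $\mu\ll\nu$ means: for every $\varepsilon>0$ there is $\delta>0$ such that $A\in\mathscr A$ and $|\nu|(A)<\delta$ imply $|\mu|(A)<\varepsilon$. For $\mathscr M\subset ba(\mathscr A)$, $$\mathbf A(\mathscr M)=\left\{\sum_{n=1}^\infty\alpha_n\frac{|\mu_n|}{1\vee\|\mu_n\|}:\ \mu_n\in\mathscr M,\ \alpha_n\ge0\text{ for }n=1,2,\ldots,\ \sum_{n}\alpha_n=1\right\},$$ where $1\vee\|\mu_n\|=\max\{1,\|\mu_n\|\}$.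
   Formalization: The family $\mathscr M$ is assumed nonempty: for $\mathscr M=\emptyset$ domination holds vacuously (take $\lambda=0$) while $\mathbf A(\emptyset)$ is empty, so the equivalence as literally stated fails in that single case. *)

theory Defs
  imports "HOL-Analysis.Analysis"
begin

text \<open>Bounded finitely additive set functions on an algebra \<open>\<A>\<close>. They are taken extensional
  on \<open>\<A>\<close>, so that equality in \<open>ba \<A>\<close> is equality of functions with domain \<open>\<A>\<close>.
  Note that additivity for real values forces \<open>\<mu> {} = 0\<close>.\<close>

definition ba :: "'a set set \<Rightarrow> ('a set \<Rightarrow> real) set" where
  "ba \<A> = {\<mu> \<in> extensional \<A>. additive \<A> \<mu> \<and> bounded (\<mu> ` \<A>)}"

definition ba_plus :: "'a set set \<Rightarrow> ('a set \<Rightarrow> real) set" where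
  "ba_plus \<A> = {\<mu> \<in> ba \<A>. \<forall>A\<in>\<A>. 0 \<le> \<mu> A}"

text \<open>The supremum over finite partitions is finite for \<open>\<mu> \<in> ba \<A>\<close> and \<open>A \<in> \<A>\<close>, so the
  real-valued \<open>SUP\<close> below is a genuine one.\<close>

definition total_var :: "'a set set \<Rightarrow> ('a set \<Rightarrow> real) \<Rightarrow> 'a set \<Rightarrow> real" where
  "total_var \<A> \<mu> =
    (\<lambda>A\<in>\<A>. SUP P\<in>{P. finite P \<and> P \<subseteq> \<A> \<and> partition_on A P}. \<Sum>B\<in>P. \<bar>\<mu> B\<bar>)"

definition ba_norm :: "'a set \<Rightarrow> 'a set set \<Rightarrow> ('a set \<Rightarrow> real) \<Rightarrow> real" where
  "ba_norm \<Omega> \<A> \<mu> = total_var \<A> \<mu> \<Omega>"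

definition abs_cont :: "'a set set \<Rightarrow> ('a set \<Rightarrow> real) \<Rightarrow> ('a set \<Rightarrow> real) \<Rightarrow> bool" where
  "abs_cont \<A> \<mu> \<nu> \<longleftrightarrow>
    (\<forall>\<epsilon>>0. \<exists>\<delta>>0. \<forall>A\<in>\<A>. total_var \<A> \<nu> A < \<delta> \<longrightarrow> total_var \<A> \<mu> A < \<epsilon>)"

text \<open>The series of set functions is summed setwise; its terms are nonnegative with norms
  at most \<open>\<alpha> n\<close>, so this is the same as summing it in norm.\<close>

definition avg_set ::
  "'a set \<Rightarrow> 'a set set \<Rightarrow> ('a set \<Rightarrow> real) set \<Rightarrow> ('a set \<Rightarrow> real) set" where
  "avg_set \<Omega> \<A> \<M> =
    {m \<in> extensional \<A>. \<exists>\<mu> \<alpha>. (\<forall>n::nat. \<mu> n \<in> \<M> \<and> 0 \<le> \<alpha> n) \<and> \<alpha> sums (1::real) \<and>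
      (\<forall>A\<in>\<A>. (\<lambda>n. \<alpha> n * (total_var \<A> (\<mu> n) A / max 1 (ba_norm \<Omega> \<A> (\<mu> n)))) sums m A)}"

definition dominated :: "'a set set \<Rightarrow> ('a set \<Rightarrow> real) set \<Rightarrow> bool" where
  "dominated \<A> \<M> \<longleftrightarrow> (\<exists>\<nu>\<in>ba_plus \<A>. \<forall>\<mu>\<in>\<M>. abs_cont \<A> \<mu> \<nu>)"

end

theory Submission
  imports Defs
begin

text \<open>Let \<open>\<nu> \<ge> 0\<close> dominate \<open>\<M>\<close>. For a finite \<open>F \<subseteq> \<M>\<close> and \<open>\<delta> > 0\<close> let \<open>g(F, \<delta>)\<close> be the
  supremum of \<open>\<nu> A\<close> over the sets with \<open>\<bar>\<mu>\<bar> A < \<delta>\<close> for all \<open>\<mu> \<in> F\<close>, let \<open>I\<close> be the infimum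
  of \<open>g\<close>, and pick \<open>(F\<^sub>k, \<delta>\<^sub>k)\<close> with \<open>g(F\<^sub>k, \<delta>\<^sub>k) \<rightarrow> I\<close>. Any average \<open>m\<close> giving positive weight
  to every element of the countable set \<open>\<Union>F\<^sub>k\<close> works: if \<open>m A\<close> is small, then \<open>A\<close> is small for
  \<open>F\<^sub>k\<close>; as \<open>g(F\<^sub>k \<union> {\<mu>}, \<cdot>) \<ge> I\<close>, some \<open>B\<close> is small for \<open>F\<^sub>k\<close> and for \<open>\<mu>\<close> and has \<open>\<nu> B\<close> almost
  \<open>I\<close>, whereas \<open>\<nu> (A \<union> B)\<close> hardly exceeds \<open>I\<close>. So \<open>\<nu> (A - B)\<close> is small, and hence so are
  \<open>\<bar>\<mu>\<bar> (A - B)\<close> and \<open>\<bar>\<mu>\<bar> A \<le> \<bar>\<mu>\<bar> (A - B) + \<bar>\<mu>\<bar> B\<close>.\<close>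

section \<open>Upper variation of a bounded finitely additive set function\<close>

text \<open>For \<mu> in \<open>ba \<A>\<close> over an algebra this is the positive part of \<mu>
  in its Jordan decomposition. The supremum runs over single subsets, so its additivity can be
  proved without refining partitions.\<close>

definition sup_below :: "'a set set \<Rightarrow> ('a set \<Rightarrow> real) \<Rightarrow> 'a set \<Rightarrow> real" where
  "sup_below \<A> \<mu> A = (SUP C\<in>{C\<in>\<A>. C \<subseteq> A}. \<mu> C)"

lemma ba_bounded:
  assumes "\<mu> \<in> ba \<A>"
  obtains K where "\<And>A. A \<in> \<A> \<Longrightarrow> \<bar>\<mu> A\<bar> \<le> K"
  using assms unfolding ba_def bounded_iff by auto

lemma bdd_above_below: "\<mu> \<in> ba \<A> \<Longrightarrow> bdd_above (\<mu> ` {C\<in>\<A>. C \<subseteq> A})"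
  by (rule ba_bounded[of \<mu> \<A>], assumption) (force simp: bdd_above_def abs_le_iff)

lemma sup_below_upper: "\<mu> \<in> ba \<A> \<Longrightarrow> C \<in> \<A> \<Longrightarrow> C \<subseteq> A \<Longrightarrow> \<mu> C \<le> sup_below \<A> \<mu> A"
  unfolding sup_below_def by (intro cSUP_upper bdd_above_below) auto

lemma sup_below_least:
  "A \<in> \<A> \<Longrightarrow> (\<And>C. C \<in> \<A> \<Longrightarrow> C \<subseteq> A \<Longrightarrow> \<mu> C \<le> x) \<Longrightarrow> sup_below \<A> \<mu> A \<le> x"
  unfolding sup_below_def by (intro cSUP_least) auto

context algebra
begin

section \<open>Finite additivity and the total variation\<close>

lemma ba_Un: "\<mu> \<in> ba M \<Longrightarrow> A \<in> M \<Longrightarrow> B \<in> M \<Longrightarrow> A \<inter> B = {} \<Longrightarrow> \<mu> (A \<union> B) = \<mu> A + \<mu> B"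
  unfolding ba_def additive_def by auto

lemma ba_empty: "\<mu> \<in> ba M \<Longrightarrow> \<mu> {} = 0"
  using ba_Un[of \<mu> "{}" "{}"] by auto

lemma ba_Diff:
  assumes "\<mu> \<in> ba M" "A \<in> M" "C \<in> M" "C \<subseteq> A"
  shows "\<mu> (A - C) = \<mu> A - \<mu> C"
proof -
  have "\<mu> (C \<union> (A - C)) = \<mu> C + \<mu> (A - C)"
    using assms by (intro ba_Un) auto
  moreover have "C \<union> (A - C) = A" using assms by auto
  ultimately show ?thesis by simp
qed

lemma ba_Union_disjoint:
  assumes "\<mu> \<in> ba M" "finite P" "P \<subseteq> M" "disjoint P"
  shows "\<mu> (\<Union>P) = sum \<mu> P"
  using assms(2-)
proof (induction P rule: finite_induct)
  case empty
  then show ?case using assms(1) by (simp add: ba_empty)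
next
  case (insert X P)
  have "X \<inter> \<Union>P = {}"
    using insert.prems(2) insert.hyps(2) by (fastforce simp: pairwise_insert disjnt_def)
  moreover have "\<Union>P \<in> M" using insert.hyps(1) insert.prems(1) by (intro finite_Union) simp_all
  ultimately have "\<mu> (X \<union> \<Union>P) = \<mu> X + \<mu> (\<Union>P)"
    using insert.prems(1) by (intro ba_Un[OF assms(1)]) simp_all
  moreover have "\<mu> (\<Union>P) = sum \<mu> P"
    using insert.prems by (intro insert.IH) (simp_all add: pairwise_insert)
  ultimately show ?case
    using insert.hyps by simp
qed

lemma ba_mono_nonneg:
  assumes "\<mu> \<in> ba_plus M" "A \<in> M" "B \<in> M" "A \<subseteq> B"
  shows "\<mu> A \<le> \<mu> B"
proof -
  have "0 \<le> \<mu> (B - A)" using assms by (auto simp: ba_plus_def)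
  also have "\<mu> (B - A) = \<mu> B - \<mu> A" using assms by (intro ba_Diff) (auto simp: ba_plus_def)
  finally show ?thesis by simp
qed

text \<open>Jordan decomposition: the negative part is the positive part minus \<mu>. Writing an
  absolute value as twice the positive part minus the number, the cells of a partition with
  nonnegative value merge into one subset of \<open>A\<close>, which gives the upper bound; the
  partition into \<open>C\<close> and \<open>A - C\<close> gives the lower one. Additivity of the
  total variation is thereby reduced to that of \<open>sup_below\<close>.\<close>

lemma total_var_eq:
  assumes \<mu>: "\<mu> \<in> ba M" and A: "A \<in> M"
  shows "total_var M \<mu> A = 2 * sup_below M \<mu> A - \<mu> A"
proof -
  let ?S = "{P. finite P \<and> P \<subseteq> M \<and> partition_on A P}"
  have le: "(\<Sum>B\<in>P. \<bar>\<mu> B\<bar>) \<le> 2 * sup_below M \<mu> A - \<mu> A" if "P \<in> ?S" for P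
  proof -
    have P: "finite P" "P \<subseteq> M" "\<Union>P = A" "disjoint P"
      using that by (auto simp: partition_on_def)
    define Q where "Q = {B\<in>P. 0 \<le> \<mu> B}"
    have Q: "finite Q" "Q \<subseteq> P" using P by (auto simp: Q_def)
    then have "disjoint Q" using P(4) by (metis pairwise_subset)
    have "(\<Sum>B\<in>P. \<bar>\<mu> B\<bar>) = (\<Sum>B\<in>P. 2 * (if 0 \<le> \<mu> B then \<mu> B else 0) - \<mu> B)"
      by (intro sum.cong) auto
    also have "\<dots> = 2 * sum \<mu> Q - sum \<mu> P"
      using P by (simp add: sum_subtractf sum_distrib_left[symmetric] Q_def sum.inter_filter)
    also have "sum \<mu> P = \<mu> A"
      using ba_Union_disjoint[OF \<mu> P(1,2,4)] P(3) by simp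
    also have "sum \<mu> Q = \<mu> (\<Union>Q)"
      using ba_Union_disjoint[OF \<mu> Q(1) _ \<open>disjoint Q\<close>] P(2) Q(2) by simp
    also have "\<mu> (\<Union>Q) \<le> sup_below M \<mu> A"
    proof (rule sup_below_upper[OF \<mu>])
      show "\<Union>Q \<in> M" using P(2) Q by (intro finite_Union) auto
      show "\<Union>Q \<subseteq> A" using P(3) Q(2) by blast
    qed
    finally show ?thesis by simp
  qed
  have ge: "2 * \<mu> C - \<mu> A \<le> (SUP P\<in>?S. \<Sum>B\<in>P. \<bar>\<mu> B\<bar>)" if C: "C \<in> M" "C \<subseteq> A" for C
  proof -
    \<comment> \<open>\<open>partition_on\<close> admits no empty cell; dropping one is harmless
      because \<mu> vanishes on it.\<close>
    let ?P = "{C, A - C} - {{}}"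
    have "2 * \<mu> C - \<mu> A = \<mu> C - \<mu> (A - C)"
      using ba_Diff[OF \<mu> A C] by simp
    also have "\<dots> \<le> (\<Sum>B\<in>?P. \<bar>\<mu> B\<bar>)"
    proof -
      have "(\<Sum>B\<in>?P. \<bar>\<mu> B\<bar>) = (\<Sum>B\<in>{C, A - C}. \<bar>\<mu> B\<bar>)"
        by (intro sum.mono_neutral_left) (auto simp: ba_empty[OF \<mu>])
      moreover have "\<mu> C - \<mu> (A - C) \<le> (\<Sum>B\<in>{C, A - C}. \<bar>\<mu> B\<bar>)"
      \<comment> \<open>\<open>C\<close> and \<open>A - C\<close> coincide only if both are empty;
        the two-element sum then collapses to one term.\<close>
      proof (cases "C = {}")
        case False
        then have "C \<noteq> A - C" by blast
        then have "(\<Sum>B\<in>{C, A - C}. \<bar>\<mu> B\<bar>) = \<bar>\<mu> C\<bar> + \<bar>\<mu> (A - C)\<bar>" by simp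
        then show ?thesis by linarith
      next
        case True
        then show ?thesis by (cases "A = {}") (simp_all add: ba_empty[OF \<mu>])
      qed
      ultimately show ?thesis by simp
    qed
    also have "\<dots> \<le> (SUP P\<in>?S. \<Sum>B\<in>P. \<bar>\<mu> B\<bar>)"
    proof (rule cSUP_upper)
      show "?P \<in> ?S"
        using A C by (auto simp: partition_on_def disjoint_def)
      show "bdd_above ((\<lambda>P. \<Sum>B\<in>P. \<bar>\<mu> B\<bar>) ` ?S)"
        using le by (rule bdd_aboveI2)
    qed
    finally show ?thesis .
  qed
  have ne: "?S \<noteq> {}"
  proof -
    have "{A} - {{}} \<in> ?S" using A by (auto simp: partition_on_def disjoint_def)
    then show ?thesis by blast
  qed
  have "(SUP P\<in>?S. \<Sum>B\<in>P. \<bar>\<mu> B\<bar>) \<le> 2 * sup_below M \<mu> A - \<mu> A"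
    using ne le by (intro cSUP_least) auto
  moreover have "sup_below M \<mu> A \<le> ((SUP P\<in>?S. \<Sum>B\<in>P. \<bar>\<mu> B\<bar>) + \<mu> A) / 2"
  proof (rule sup_below_least[OF A])
    fix C assume "C \<in> M" "C \<subseteq> A"
    from ge[OF this] show "\<mu> C \<le> ((SUP P\<in>?S. \<Sum>B\<in>P. \<bar>\<mu> B\<bar>) + \<mu> A) / 2" by simp
  qed
  ultimately show ?thesis
    using A by (simp add: total_var_def)
qed

text \<open>A subset of the union splits along \<open>A\<close> and \<open>B\<close>, and conversely
  a subset of \<open>A\<close> and one of \<open>B\<close> combine to a subset of the union.\<close>

lemma sup_below_Un:
  assumes \<mu>: "\<mu> \<in> ba M" and A: "A \<in> M" and B: "B \<in> M" and disj: "A \<inter> B = {}"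
  shows "sup_below M \<mu> (A \<union> B) = sup_below M \<mu> A + sup_below M \<mu> B"
proof (rule antisym)
  show "sup_below M \<mu> (A \<union> B) \<le> sup_below M \<mu> A + sup_below M \<mu> B"
  proof (rule sup_below_least)
    fix C assume C: "C \<in> M" "C \<subseteq> A \<union> B"
    have "\<mu> ((C \<inter> A) \<union> (C \<inter> B)) = \<mu> (C \<inter> A) + \<mu> (C \<inter> B)"
      using A B C disj by (intro ba_Un[OF \<mu>]) auto
    moreover have "(C \<inter> A) \<union> (C \<inter> B) = C" using C by auto
    ultimately show "\<mu> C \<le> sup_below M \<mu> A + sup_below M \<mu> B"
      using sup_below_upper[OF \<mu>, of "C \<inter> A" A] sup_below_upper[OF \<mu>, of "C \<inter> B" B]
        Int[OF C(1) A] Int[OF C(1) B] by simp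
  qed (use A B in auto)
next
  have *: "\<mu> C + \<mu> D \<le> sup_below M \<mu> (A \<union> B)"
    if "C \<in> M" "C \<subseteq> A" "D \<in> M" "D \<subseteq> B" for C D
  proof -
    have "\<mu> (C \<union> D) = \<mu> C + \<mu> D" using that disj by (intro ba_Un[OF \<mu>]) auto
    then show ?thesis using sup_below_upper[OF \<mu>, of "C \<union> D" "A \<union> B"] that by auto
  qed
  \<comment> \<open>The two suprema are taken one after the other: first over subsets of
    \<open>A\<close> with \<open>D\<close> fixed, then over \<open>D\<close>.\<close>
  have "sup_below M \<mu> A \<le> sup_below M \<mu> (A \<union> B) - \<mu> D" if "D \<in> M" "D \<subseteq> B" for D
    by (rule sup_below_least[OF A]) (use * that in fastforce)
  then have "sup_below M \<mu> B \<le> sup_below M \<mu> (A \<union> B) - sup_below M \<mu> A"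
    by (intro sup_below_least[OF B]) fastforce
  then show "sup_below M \<mu> A + sup_below M \<mu> B \<le> sup_below M \<mu> (A \<union> B)" by simp
qed

lemma total_var_Un:
  assumes "\<mu> \<in> ba M" "A \<in> M" "B \<in> M" "A \<inter> B = {}"
  shows "total_var M \<mu> (A \<union> B) = total_var M \<mu> A + total_var M \<mu> B"
  using assms by (simp add: total_var_eq Un sup_below_Un ba_Un)

lemma total_var_empty: "\<mu> \<in> ba M \<Longrightarrow> total_var M \<mu> {} = 0"
  using total_var_Un[of \<mu> "{}" "{}"] by auto

lemma total_var_nonneg:
  assumes "\<mu> \<in> ba M" "A \<in> M"
  shows "0 \<le> total_var M \<mu> A"
  using sup_below_upper[OF assms(1), of A A] sup_below_upper[OF assms(1), of "{}" A] assms
  by (simp add: total_var_eq ba_empty)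

lemma total_var_mono:
  assumes "\<mu> \<in> ba M" "A \<in> M" "B \<in> M" "A \<subseteq> B"
  shows "total_var M \<mu> A \<le> total_var M \<mu> B"
proof -
  have "total_var M \<mu> (A \<union> (B - A)) = total_var M \<mu> A + total_var M \<mu> (B - A)"
    using assms by (intro total_var_Un) auto
  moreover have "A \<union> (B - A) = B" using assms by auto
  ultimately show ?thesis using total_var_nonneg[of \<mu> "B - A"] assms by auto
qed

lemma total_var_subadditive:
  assumes "\<mu> \<in> ba M" "A \<in> M" "B \<in> M"
  shows "total_var M \<mu> (A \<union> B) \<le> total_var M \<mu> A + total_var M \<mu> B"
proof -
  have "total_var M \<mu> ((A - B) \<union> B) = total_var M \<mu> (A - B) + total_var M \<mu> B"
    using assms by (intro total_var_Un) auto
  then show ?thesis using total_var_mono[of \<mu> "A - B" A] assms by auto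
qed

lemma total_var_ba_plus:
  assumes "\<nu> \<in> ba_plus M" "A \<in> M"
  shows "total_var M \<nu> A = \<nu> A"
proof -
  have \<nu>: "\<nu> \<in> ba M" using assms by (auto simp: ba_plus_def)
  have "sup_below M \<nu> A = \<nu> A"
    using assms by (intro antisym sup_below_least sup_below_upper[OF \<nu>])
      (auto intro: ba_mono_nonneg)
  then show ?thesis using total_var_eq[OF \<nu> assms(2)] by simp
qed

section \<open>Normalized variations and their averages\<close>

definition normalized_var :: "('a set \<Rightarrow> real) \<Rightarrow> 'a set \<Rightarrow> real" where
  "normalized_var \<mu> A = total_var M \<mu> A / max 1 (ba_norm \<Omega> M \<mu>)"

lemma normalized_var_nonneg: "\<mu> \<in> ba M \<Longrightarrow> A \<in> M \<Longrightarrow> 0 \<le> normalized_var \<mu> A"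
  unfolding normalized_var_def by (intro divide_nonneg_pos total_var_nonneg) auto

lemma normalized_var_le_1: "\<mu> \<in> ba M \<Longrightarrow> A \<in> M \<Longrightarrow> normalized_var \<mu> A \<le> 1"
  using total_var_mono[of \<mu> A \<Omega>] sets_into_space
  by (auto simp: normalized_var_def ba_norm_def divide_le_eq_1 max_def)

lemma normalized_var_Un:
  assumes "\<mu> \<in> ba M" "A \<in> M" "B \<in> M" "A \<inter> B = {}"
  shows "normalized_var \<mu> (A \<union> B) = normalized_var \<mu> A + normalized_var \<mu> B"
  using total_var_Un[OF assms] by (simp add: normalized_var_def add_divide_distrib)

text \<open>The normalized variations lie between 0 and 1 and the weights sum to 1, so averages have
  the same bounds; additivity passes through the convergent series. Hence an average is itself an
  admissible dominating measure.\<close>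

lemma avg_set_subset_ba_plus:
  assumes \<M>: "\<M> \<subseteq> ba M"
  shows "avg_set \<Omega> M \<M> \<subseteq> ba_plus M"
proof
  fix m assume "m \<in> avg_set \<Omega> M \<M>"
  then obtain \<mu> \<alpha> where m: "m \<in> extensional M" "\<And>n::nat. \<mu> n \<in> \<M>" "\<And>n. 0 \<le> \<alpha> n"
    "\<alpha> sums (1::real)" "\<And>A. A \<in> M \<Longrightarrow> (\<lambda>n. \<alpha> n * normalized_var (\<mu> n) A) sums m A"
    unfolding avg_set_def normalized_var_def by auto
  have \<mu>: "\<mu> n \<in> ba M" for n using m(2) \<M> by auto
  have nonneg: "0 \<le> m A" if "A \<in> M" for A
    by (rule sums_le[OF _ sums_zero m(5)[OF that]])
      (use m(3) normalized_var_nonneg[OF \<mu> that] in simp)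
  have le1: "m A \<le> 1" if "A \<in> M" for A
    by (rule sums_le[OF _ m(5)[OF that] m(4)])
      (use m(3) normalized_var_le_1[OF \<mu> that] in \<open>simp add: mult_left_le\<close>)
  have "m (A \<union> B) = m A + m B" if AB: "A \<in> M" "B \<in> M" "A \<inter> B = {}" for A B
  proof -
    have "(\<lambda>n. \<alpha> n * normalized_var (\<mu> n) (A \<union> B)) sums (m A + m B)"
      using sums_add[OF m(5)[OF AB(1)] m(5)[OF AB(2)]]
      by (simp add: normalized_var_Un[OF \<mu> AB] distrib_left)
    then show ?thesis using m(5)[of "A \<union> B"] AB sums_unique2 by blast
  qed
  moreover have "bounded (m ` M)"
    unfolding bounded_iff using nonneg le1 by (auto intro!: exI[of _ 1])
  ultimately show "m \<in> ba_plus M"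
    using m(1) nonneg by (auto simp: ba_plus_def ba_def additive_def)
qed

text \<open>The exponent \<open>Suc n\<close> makes the weights sum to 1, and every weight is
  positive.\<close>

definition geometric_avg :: "(nat \<Rightarrow> 'a set \<Rightarrow> real) \<Rightarrow> 'a set \<Rightarrow> real" where
  "geometric_avg \<mu> = (\<lambda>A\<in>M. \<Sum>n. (1/2) ^ Suc n * normalized_var (\<mu> n) A)"

lemma geometric_avg_sums:
  assumes \<mu>: "\<And>n. \<mu> n \<in> ba M" and A: "A \<in> M"
  shows "(\<lambda>n. (1/2) ^ Suc n * normalized_var (\<mu> n) A) sums geometric_avg \<mu> A"
proof -
  have "norm ((1/2) ^ Suc n * normalized_var (\<mu> n) A) \<le> (1/2) ^ Suc n" for n
    using normalized_var_nonneg[OF \<mu> A, of n] normalized_var_le_1[OF \<mu> A, of n]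
    by (simp add: abs_mult)
  then have "summable (\<lambda>n. (1/2) ^ Suc n * normalized_var (\<mu> n) A)"
    by (intro summable_comparison_test'[OF sums_summable[OF power_half_series]])
  then show ?thesis using A by (simp add: geometric_avg_def summable_sums)
qed

lemma geometric_avg_in_avg_set:
  assumes \<M>: "\<M> \<subseteq> ba M" and \<mu>: "range \<mu> \<subseteq> \<M>"
  shows "geometric_avg \<mu> \<in> avg_set \<Omega> M \<M>"
proof -
  have "geometric_avg \<mu> \<in> extensional M" by (simp add: geometric_avg_def)
  moreover have "\<And>n. \<mu> n \<in> ba M" using assms by blast
  ultimately show ?thesis
    unfolding avg_set_def using geometric_avg_sums[of \<mu>] power_half_series \<mu>
    by (auto simp: normalized_var_def intro!: exI[of _ \<mu>] exI[of _ "\<lambda>n. (1/2) ^ Suc n"])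
qed

lemma geometric_avg_ge:
  assumes \<mu>: "\<And>n. \<mu> n \<in> ba M" and A: "A \<in> M"
  shows "(1/2) ^ Suc n * normalized_var (\<mu> n) A \<le> geometric_avg \<mu> A"
proof -
  note s = geometric_avg_sums[of \<mu>, OF \<mu> A]
  have "(\<Sum>i\<in>{n}. (1/2) ^ Suc i * normalized_var (\<mu> i) A)
      \<le> (\<Sum>i. (1/2) ^ Suc i * normalized_var (\<mu> i) A)"
    by (intro sum_le_suminf sums_summable[OF s]) (auto simp: normalized_var_nonneg[OF \<mu> A])
  then show ?thesis using sums_unique[OF s] by simp
qed

text \<open>A single term of the series is at most the whole, so a small average forces each
  enumerated variation to be small; finiteness of \<open>F\<close> allows one threshold for all its
  members.\<close>

lemma geometric_avg_small:
  assumes \<mu>: "\<And>n. \<mu> n \<in> ba M" and F: "finite F" "F \<subseteq> range \<mu>" and \<eta>: "0 < \<eta>"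
  obtains \<delta> where "0 < \<delta>"
    "\<And>A \<kappa>. A \<in> M \<Longrightarrow> geometric_avg \<mu> A < \<delta> \<Longrightarrow> \<kappa> \<in> F \<Longrightarrow> total_var M \<kappa> A < \<eta>"
proof -
  have "\<exists>\<delta>>0. \<forall>A\<in>M. geometric_avg \<mu> A < \<delta> \<longrightarrow> total_var M \<kappa> A < \<eta>" if "\<kappa> \<in> F" for \<kappa>
  proof -
    obtain n where n: "\<kappa> = \<mu> n"
      using F(2) \<open>\<kappa> \<in> F\<close> by (metis imageE subsetD)
    let ?c = "max 1 (ba_norm \<Omega> M \<kappa>)"
    have c: "0 < ?c" by auto
    let ?\<delta> = "(1/2) ^ Suc n * (\<eta> / ?c)"
    have "total_var M \<kappa> A < \<eta>" if "A \<in> M" "geometric_avg \<mu> A < ?\<delta>" for A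
    proof -
      have "(1/2) ^ Suc n * normalized_var \<kappa> A < ?\<delta>"
        using le_less_trans[OF geometric_avg_ge[of \<mu> A n, OF \<mu> that(1)] that(2)] by (simp only: n)
      then have "normalized_var \<kappa> A < \<eta> / ?c"
        by (simp only: mult_less_cancel_left_pos zero_less_power zero_less_divide_1_iff
            zero_less_numeral)
      then show ?thesis using c by (simp only: normalized_var_def divide_less_cancel)
    qed
    moreover have "0 < ?\<delta>" using c \<eta> by simp
    ultimately show ?thesis by blast
  qed
  then obtain d where d: "\<And>\<kappa>. \<kappa> \<in> F \<Longrightarrow> 0 < d \<kappa>"
    "\<And>\<kappa> A. \<kappa> \<in> F \<Longrightarrow> A \<in> M \<Longrightarrow> geometric_avg \<mu> A < d \<kappa> \<Longrightarrow> total_var M \<kappa> A < \<eta>"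
    by metis
  \<comment> \<open>The inserted 1 keeps the minimum meaningful when \<open>F\<close> is
    empty.\<close>
  let ?\<delta> = "Min (insert 1 (d ` F))"
  have "0 < ?\<delta>" using F d by auto
  moreover have "?\<delta> \<le> d \<kappa>" if "\<kappa> \<in> F" for \<kappa> using F that by auto
  ultimately show ?thesis using d that[of ?\<delta>] by (meson less_le_trans)
qed

section \<open>Exhaustion by sets that are small for finite subfamilies\<close>

definition small_sets :: "('a set \<Rightarrow> real) set \<Rightarrow> real \<Rightarrow> 'a set set" where
  "small_sets F \<delta> = {A\<in>M. \<forall>\<mu>\<in>F. total_var M \<mu> A < \<delta>}"

lemma dominated_imp_avg:
  assumes \<M>: "\<M> \<subseteq> ba M" "\<M> \<noteq> {}" and \<nu>: "\<nu> \<in> ba_plus M"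
    and dom: "\<And>\<mu>. \<mu> \<in> \<M> \<Longrightarrow> abs_cont M \<mu> \<nu>"
  shows "\<exists>m\<in>avg_set \<Omega> M \<M>. \<forall>\<mu>\<in>\<M>. abs_cont M \<mu> m"
proof -
  have \<nu>': "\<nu> \<in> ba M" using \<nu> by (simp add: ba_plus_def)
  define g where "g F \<delta> = (SUP A\<in>small_sets F \<delta>. \<nu> A)" for F \<delta>
  define T where "T = {(F, \<delta>). finite F \<and> F \<subseteq> \<M> \<and> (0::real) < \<delta>}"
  define I where "I = (INF (F, \<delta>)\<in>T. g F \<delta>)"
  have small_M: "A \<in> M" if "A \<in> small_sets F \<delta>" for A F \<delta>
    using that by (simp add: small_sets_def)
  have empty_small: "{} \<in> small_sets F \<delta>" if "(F, \<delta>) \<in> T" for F \<delta>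
    using that \<M> by (auto simp: T_def small_sets_def subset_iff total_var_empty)
  have bdd: "bdd_above (\<nu> ` small_sets F \<delta>)" for F \<delta>
    by (rule bdd_aboveI2[where M="\<nu> \<Omega>"])
      (use ba_mono_nonneg[OF \<nu>] small_M sets_into_space in auto)
  have g_upper: "\<nu> A \<le> g F \<delta>" if "A \<in> small_sets F \<delta>" for A F \<delta>
    unfolding g_def using that bdd by (rule cSUP_upper)
  have "0 \<le> g F \<delta>" if "(F, \<delta>) \<in> T" for F \<delta>
    using g_upper[OF empty_small[OF that]] by (simp add: ba_empty[OF \<nu>'])
  then have bdd_g: "bdd_below ((\<lambda>(F, \<delta>). g F \<delta>) ` T)"
    by (intro bdd_belowI2[where m=0]) auto
  have I_le: "I \<le> g F \<delta>" if "(F, \<delta>) \<in> T" for F \<delta>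
    unfolding I_def using cINF_lower[OF bdd_g that] by simp
  \<comment> \<open>This makes \<open>T\<close> nonempty, so that its infimum \<open>I\<close> can
    be approximated.\<close>
  have "({}, 1) \<in> T" by (simp add: T_def)
  then have "\<exists>p\<in>T. (\<lambda>(F, \<delta>). g F \<delta>) p < I + 1 / Suc k" for k
    unfolding I_def by (subst cINF_less_iff[symmetric]) (use bdd_g in auto)
  then have "\<exists>F \<delta>. (F, \<delta>) \<in> T \<and> g F \<delta> < I + 1 / Suc k" for k
    by fast
  then obtain F d where Fd: "\<And>k. (F k, d k) \<in> T" "\<And>k. g (F k) (d k) < I + 1 / Suc k"
    by metis
  have F: "finite (F k)" "F k \<subseteq> \<M>" "0 < d k" for k
    using Fd(1)[of k] by (auto simp: T_def)
  obtain \<mu>\<^sub>0 where \<mu>\<^sub>0: "\<mu>\<^sub>0 \<in> \<M>" using \<M> by auto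
  \<comment> \<open>The extra \<open>\<mu>\<^sub>0\<close> keeps \<open>C\<close> nonempty even if
    every \<open>F k\<close> is empty, so \<open>C\<close> is the range of a sequence, possibly with
    repetitions.\<close>
  define C where "C = insert \<mu>\<^sub>0 (\<Union>k. F k)"
  have "countable C" "C \<noteq> {}" "C \<subseteq> \<M>"
    using F \<mu>\<^sub>0 by (auto simp: C_def intro: countable_finite)
  then obtain \<mu>s :: "nat \<Rightarrow> 'a set \<Rightarrow> real" where \<mu>s: "range \<mu>s = C"
    by (metis range_from_nat_into)
  have \<mu>s_ba: "\<mu>s n \<in> ba M" for n
    using \<mu>s \<M> \<open>C \<subseteq> \<M>\<close> by blast
  let ?m = "geometric_avg \<mu>s"
  have m_avg: "?m \<in> avg_set \<Omega> M \<M>"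
    using \<M>(1) \<mu>s \<open>C \<subseteq> \<M>\<close> by (intro geometric_avg_in_avg_set) auto
  then have m_ba: "?m \<in> ba_plus M"
    using avg_set_subset_ba_plus[OF \<M>(1)] by blast
  have "abs_cont M \<mu> ?m" if \<mu>: "\<mu> \<in> \<M>" for \<mu>
    unfolding abs_cont_def
  proof (intro allI impI)
    fix \<epsilon> :: real assume \<epsilon>: "0 < \<epsilon>"
    have \<mu>_ba: "\<mu> \<in> ba M" using \<mu> \<M> by blast
    obtain \<delta>\<^sub>0 where \<delta>\<^sub>0: "0 < \<delta>\<^sub>0"
      "\<And>A. A \<in> M \<Longrightarrow> total_var M \<nu> A < \<delta>\<^sub>0 \<Longrightarrow> total_var M \<mu> A < \<epsilon> / 2"
      using dom[OF \<mu>] \<epsilon> unfolding abs_cont_def by (meson half_gt_zero)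
    \<comment> \<open>\<open>\<delta>\<^sub>0\<close> is split in halves: one for the excess of
      \<open>g (F k) (d k)\<close> over \<open>I\<close>, one for the shortfall of \<nu> on
      \<open>B\<close> below \<open>I\<close>.\<close>
    obtain k :: nat where k: "1 / Suc k < \<delta>\<^sub>0 / 2"
      using nat_approx_posE[of "\<delta>\<^sub>0 / 2"] \<delta>\<^sub>0 by auto
    obtain \<delta> where \<delta>: "0 < \<delta>"
      "\<And>A \<kappa>. A \<in> M \<Longrightarrow> ?m A < \<delta> \<Longrightarrow> \<kappa> \<in> F k \<Longrightarrow> total_var M \<kappa> A < d k / 2"
      using geometric_avg_small[of \<mu>s "F k" "d k / 2"] \<mu>s_ba \<mu>s F unfolding C_def
      by (metis SUP_upper UNIV_I half_gt_zero insert_subset order_trans subset_insertI)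
    \<comment> \<open>The bound \<open>d k / 2\<close> leaves room for \<open>A\<close> when
      \<open>A \<union> B\<close> is tested against \<open>F k\<close>; the bound \<epsilon>/2
      serves the final estimate for \<mu>.\<close>
    let ?\<eta> = "min (d k / 2) (\<epsilon> / 2)"
    have T: "(insert \<mu> (F k), ?\<eta>) \<in> T"
      using F \<mu> \<epsilon> by (auto simp: T_def)
    have "I - \<delta>\<^sub>0 / 2 < g (insert \<mu> (F k)) ?\<eta>"
      using I_le[OF T] \<delta>\<^sub>0 by simp
    then obtain B where B: "B \<in> small_sets (insert \<mu> (F k)) ?\<eta>" "I - \<delta>\<^sub>0 / 2 < \<nu> B"
      unfolding g_def using less_cSUP_iff[OF _ bdd] empty_small[OF T] by blast
    have "total_var M \<mu> A < \<epsilon>" if A: "A \<in> M" "total_var M ?m A < \<delta>" for A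
    proof -
      have BM: "B \<in> M" using small_M B by blast
      have mA: "?m A < \<delta>" using A total_var_ba_plus[OF m_ba] by simp
      have "total_var M \<kappa> (A \<union> B) < d k" if \<kappa>: "\<kappa> \<in> F k" for \<kappa>
      proof -
        have "\<kappa> \<in> ba M" using \<kappa> F \<M> by blast
        moreover have "total_var M \<kappa> B < d k / 2" using B \<kappa> by (auto simp: small_sets_def)
        ultimately show ?thesis
          using total_var_subadditive[of \<kappa> A B] \<delta>(2)[OF A(1) mA \<kappa>] A BM by linarith
      qed
      then have "A \<union> B \<in> small_sets (F k) (d k)"
        using A BM by (auto simp: small_sets_def)
      from g_upper[OF this] have "\<nu> (A \<union> B) < I + \<delta>\<^sub>0 / 2"
        using Fd(2)[of k] k by linarith
      \<comment> \<open>Subtracting the lower bound for \<nu> on \<open>B\<close> from the upper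
        bound on the union cancels \<open>I\<close> and leaves less than
        \<open>\<delta>\<^sub>0\<close>.\<close>
      moreover have "\<nu> ((A - B) \<union> B) = \<nu> (A - B) + \<nu> B"
        using A BM by (intro ba_Un[OF \<nu>']) auto
      ultimately have "\<nu> (A - B) < \<delta>\<^sub>0" using B by simp
      then have "total_var M \<mu> (A - B) < \<epsilon> / 2"
        using \<delta>\<^sub>0(2)[of "A - B"] total_var_ba_plus[OF \<nu>, of "A - B"] A BM by auto
      moreover have "total_var M \<mu> B < \<epsilon> / 2" using B by (auto simp: small_sets_def)
      moreover have "total_var M \<mu> A \<le> total_var M \<mu> ((A - B) \<union> B)"
        using A BM by (intro total_var_mono[OF \<mu>_ba]) auto
      ultimately show ?thesis
        using total_var_subadditive[OF \<mu>_ba, of "A - B" B] Diff[OF A(1) BM] BM by simp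
    qed
    then show "\<exists>\<delta>>0. \<forall>A\<in>M. total_var M ?m A < \<delta> \<longrightarrow> total_var M \<mu> A < \<epsilon>"
      using \<delta>(1) by blast
  qed
  then show ?thesis using m_avg by blast
qed

end

text \<open>For empty \<open>\<M>\<close> there are no sequences to average, so
  \<open>avg_set\<close> is empty, while domination holds vacuously; hence the assumption that
  \<open>\<M>\<close> is nonempty.\<close>

theorem theorem1:
  fixes \<Omega> :: "'a set" and \<A> :: "'a set set" and \<M> :: "('a set \<Rightarrow> real) set"
  assumes "\<Omega> \<noteq> {}" and "algebra \<Omega> \<A>"
    and "\<M> \<subseteq> ba \<A>" and "\<M> \<noteq> {}"
  shows "dominated \<A> \<M> \<longleftrightarrow> (\<exists>m\<in>avg_set \<Omega> \<A> \<M>. \<forall>\<mu>\<in>\<M>. abs_cont \<A> \<mu> m)"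
  \<comment> \<open>The first fact gives the forward direction; by the second, an average can be
    taken as the dominating measure.\<close>
  using algebra.dominated_imp_avg[OF assms(2-4)] algebra.avg_set_subset_ba_plus[OF assms(2,3)]
  unfolding dominated_def by blast

end
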